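(* Let $\hat g,g:\mathbb{R}\to\mathbb{R}$ be two arbitrary differentiable, monotone increasing and strictly convex functions. If $x^*$ is an optimal solution of the convex program $\mathscr{P}^{\hat g}$, then $x^*$ is also an optimal solution of $\mathscr{P}^{g}$.
   Context: $G=(D,S,E)$ is a finite bipartite graph with $D=D_1\cup D_2$ (disjoint), supply weights $w_j>0$ ($j\in S$); for $i\in D_1$, $N(i)$ is its neighbourhood in $S$, and for $j\in S$, $N(j)$ is its neighbourhood in $D_1$. For a function $h$, $\mathscr{P}^h$ is the program: minimize $\sum_{j\in S}\frac{1}{w_j}h\big(w_j(1-\sum_{i\in N(j)}x_{ij})\big)$ subject to $\sum_{j\in N(i)}x_{ij}\le1$ ($i\in D_1$), $\sum_{i\in N(j)}x_{ij}\le1$ ($j\in S$), $x_{ij}\ge0$ ($(i,j)\in E$, $i\in D_1$). *)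

theory Defs
  imports "HOL-Analysis.Analysis"
begin

definition strictly_convex_on :: "'a::real_vector set \<Rightarrow> ('a \<Rightarrow> real) \<Rightarrow> bool" where
  "strictly_convex_on A f \<longleftrightarrow> convex A \<and>
     (\<forall>x\<in>A. \<forall>y\<in>A. \<forall>u>0. \<forall>v>0. x \<noteq> y \<longrightarrow> u + v = 1 \<longrightarrow>
        f (u *\<^sub>R x + v *\<^sub>R y) < u * f x + v * f y)"

text \<open>
  Demand vertices and supply vertices live in two separate types, and an edge is a pair
  (demand vertex, supply vertex).
\<close>

definition bipartite_graph :: "'d set \<Rightarrow> 's set \<Rightarrow> ('d \<times> 's) set \<Rightarrow> bool" where
  "bipartite_graph D S E \<longleftrightarrow> finite D \<and> finite S \<and> E \<subseteq> D \<times> S"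

definition supply_nbrs :: "'s set \<Rightarrow> ('d \<times> 's) set \<Rightarrow> 'd \<Rightarrow> 's set" where
  "supply_nbrs S E i = {j \<in> S. (i, j) \<in> E}"

definition demand_nbrs :: "'d set \<Rightarrow> ('d \<times> 's) set \<Rightarrow> 's \<Rightarrow> 'd set" where
  "demand_nbrs D1 E j = {i \<in> D1. (i, j) \<in> E}"

text \<open>
  A point of the program is a function \<open>x\<close>, where \<open>x i j\<close> is the variable of the edge
  \<open>(i, j)\<close> with \<open>i \<in> D1\<close>. The values of \<open>x\<close> at all other pairs are irrelevant: they occur
  neither in the constraints nor in the objective.
\<close>

definition feasible ::
  "'d set \<Rightarrow> 's set \<Rightarrow> ('d \<times> 's) set \<Rightarrow> ('d \<Rightarrow> 's \<Rightarrow> real) \<Rightarrow> bool" where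
  "feasible D1 S E x \<longleftrightarrow>
     (\<forall>i\<in>D1. (\<Sum>j\<in>supply_nbrs S E i. x i j) \<le> 1) \<and>
     (\<forall>j\<in>S. (\<Sum>i\<in>demand_nbrs D1 E j. x i j) \<le> 1) \<and>
     (\<forall>(i, j)\<in>E. i \<in> D1 \<longrightarrow> 0 \<le> x i j)"

definition objective ::
  "'d set \<Rightarrow> 's set \<Rightarrow> ('d \<times> 's) set \<Rightarrow> ('s \<Rightarrow> real) \<Rightarrow> (real \<Rightarrow> real) \<Rightarrow> ('d \<Rightarrow> 's \<Rightarrow> real) \<Rightarrow> real"
where
  "objective D1 S E w h x =
     (\<Sum>j\<in>S. 1 / w j * h (w j * (1 - (\<Sum>i\<in>demand_nbrs D1 E j. x i j))))"

definition optimal_solution ::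
  "'d set \<Rightarrow> 's set \<Rightarrow> ('d \<times> 's) set \<Rightarrow> ('s \<Rightarrow> real) \<Rightarrow> (real \<Rightarrow> real) \<Rightarrow> ('d \<Rightarrow> 's \<Rightarrow> real) \<Rightarrow> bool"
where
  "optimal_solution D1 S E w h x \<longleftrightarrow> is_arg_min (objective D1 S E w h) (feasible D1 S E) x"

end

theory Submission
  imports Defs
begin

text \<open>
  Optimality has a description in which the cost function does not occur. Let
  \<open>t j = w j * (1 - load j)\<close>, so that one more unit of load at \<open>j\<close> saves \<open>h' (t j)\<close>, and suppose
  that an alternating path leads from an unsaturated supply vertex \<open>p\<close> to \<open>q\<close>. Shifting load along
  the path from \<open>q\<close> to \<open>p\<close> must not pay, and as \<open>h'\<close> is strictly increasing this says that
  \<open>t p \<le> t q\<close>; and as \<open>h'\<close> is positive, no demand neighbour of \<open>q\<close> has capacity to spare.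
  Conversely, if these two conditions hold, then letting the price of \<open>q\<close> be the largest
  \<open>h' (t p)\<close> over all such \<open>p\<close>, or \<open>0\<close> if there is none, gives a solution of the dual of the
  linearised program that satisfies complementary slackness, and linearisation is enough by
  convexity.
\<close>

section \<open>Differentiable strictly convex functions\<close>

lemma strictly_convex_on_imp_convex_on:
  assumes "strictly_convex_on A f"
  shows "convex_on A f"
proof (rule convex_onI)
  show "convex A" using assms by (simp add: strictly_convex_on_def)
  fix t :: real and x y assume t: "0 < t" "t < 1" and xy: "x \<in> A" "y \<in> A"
  show "f ((1 - t) *\<^sub>R x + t *\<^sub>R y) \<le> (1 - t) * f x + t * f y"
  proof (cases "x = y")
    case True
    then show ?thesis by (simp add: algebra_simps)
  next
    case False
    then show ?thesis
      using assms t xy unfolding strictly_convex_on_def by (simp add: less_imp_le)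
  qed
qed

lemma strictly_convex_on_imp_strictly_above_tangent:
  fixes f :: "real \<Rightarrow> real"
  assumes convex: "strictly_convex_on A f" and a: "a \<in> interior A" and b: "b \<in> A" "b \<noteq> a"
    and deriv: "(f has_real_derivative f') (at a within A)"
  shows "f' * (b - a) < f b - f a"
proof -
  define m where "m = (1/2) *\<^sub>R a + (1/2) *\<^sub>R b"
  have "a \<in> A" using a interior_subset by blast
  have "convex A" using convex by (simp add: strictly_convex_on_def)
  then have "m \<in> A" unfolding m_def using \<open>a \<in> A\<close> b(1) by (intro convexD) auto
  then have "f' * (m - a) \<le> f m - f a"
    using convex_on_imp_above_tangent[OF strictly_convex_on_imp_convex_on[OF convex] _ a _ deriv]
      convex_connected[OF \<open>convex A\<close>] by blast
  moreover have "f m < 1/2 * f a + 1/2 * f b"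
    unfolding m_def
    by (rule convex[unfolded strictly_convex_on_def, THEN conjunct2, rule_format])
      (use \<open>a \<in> A\<close> b in auto)
  moreover have "f' * (m - a) = f' * (b - a) / 2" by (simp add: m_def field_simps)
  ultimately show ?thesis by linarith
qed

lemma strictly_convex_on_imp_deriv_strict_mono_on:
  fixes f :: "real \<Rightarrow> real"
  assumes convex: "strictly_convex_on A f"
    and deriv: "\<And>a. a \<in> interior A \<Longrightarrow> (f has_real_derivative f' a) (at a within A)"
  shows "strict_mono_on (interior A) f'"
proof (rule strict_mono_onI)
  fix a b assume ab: "a \<in> interior A" "b \<in> interior A" "a < b"
  then have "a \<in> A" "b \<in> A" using interior_subset by auto
  then have "f' a * (b - a) < f b - f a" "f' b * (a - b) < f a - f b"
    using ab by (auto intro!: strictly_convex_on_imp_strictly_above_tangent[OF convex] deriv)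
  then have "f' a * (b - a) < f' b * (b - a)" by (simp add: algebra_simps)
  then show "f' a < f' b" using ab(3) by simp
qed

lemma mono_strict_mono_deriv_pos:
  fixes f :: "real \<Rightarrow> real"
  assumes "mono f" and "\<And>a. (f has_real_derivative f' a) (at a)" and "strict_mono f'"
  shows "0 < f' a"
proof -
  have "0 \<le> f' (a - 1)"
    using assms(1,2) by (intro mono_on_imp_deriv_nonneg[of UNIV f]) auto
  also have "\<dots> < f' a" using assms(3) by (simp add: strict_mono_less)
  finally show ?thesis .
qed

section \<open>The first-order condition\<close>

lemma eventually_affine_le:
  fixes a b c :: real
  assumes "a \<le> c" and "a = c \<Longrightarrow> b \<le> 0"
  shows "\<forall>\<^sub>F r in at_right 0. a + r * b \<le> c"
proof (cases "a = c")
  case True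
  then show ?thesis using assms(2) eventually_at_right_less[of "0::real"]
    by (auto elim!: eventually_mono intro: mult_nonneg_nonpos)
next
  case False
  have "((\<lambda>r. a + r * b) \<longlongrightarrow> a + 0 * b) (at_right 0)" by (intro tendsto_intros)
  then have "\<forall>\<^sub>F r in at_right 0. a + r * b < c"
    using False assms(1) by (intro order_tendstoD(2)) auto
  then show ?thesis by (auto elim: eventually_mono)
qed

locale allocation_program =
  fixes D1 :: "'d set" and S :: "'s set" and E :: "('d \<times> 's) set" and w :: "'s \<Rightarrow> real"
  assumes finite_demand: "finite D1" and finite_supply: "finite S"
    and edge_supply: "(i, j) \<in> E \<Longrightarrow> j \<in> S"
    and weight_pos: "j \<in> S \<Longrightarrow> 0 < w j"
begin

abbreviation load :: "('d \<Rightarrow> 's \<Rightarrow> real) \<Rightarrow> 's \<Rightarrow> real" where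
  "load x j \<equiv> (\<Sum>i\<in>demand_nbrs D1 E j. x i j)"

abbreviation usage :: "('d \<Rightarrow> 's \<Rightarrow> real) \<Rightarrow> 'd \<Rightarrow> real" where
  "usage x i \<equiv> (\<Sum>j\<in>supply_nbrs S E i. x i j)"

definition residual :: "('d \<Rightarrow> 's \<Rightarrow> real) \<Rightarrow> 's \<Rightarrow> real" where
  "residual x j = w j * (1 - load x j)"

lemma feasibleD:
  assumes "feasible D1 S E x"
  shows "i \<in> D1 \<Longrightarrow> usage x i \<le> 1"
    and "j \<in> S \<Longrightarrow> load x j \<le> 1"
    and "(i, j) \<in> E \<Longrightarrow> i \<in> D1 \<Longrightarrow> 0 \<le> x i j"
  using assms by (auto simp: feasible_def)

definition feasible_direction :: "('d \<Rightarrow> 's \<Rightarrow> real) \<Rightarrow> ('d \<Rightarrow> 's \<Rightarrow> real) \<Rightarrow> bool" where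
  "feasible_direction x d \<longleftrightarrow>
     (\<forall>i\<in>D1. usage x i = 1 \<longrightarrow> usage d i \<le> 0) \<and>
     (\<forall>j\<in>S. load x j = 1 \<longrightarrow> load d j \<le> 0) \<and>
     (\<forall>(i, j)\<in>E. i \<in> D1 \<longrightarrow> x i j = 0 \<longrightarrow> 0 \<le> d i j)"

lemma eventually_feasible_along_direction:
  assumes x: "feasible D1 S E x" and d: "feasible_direction x d"
  shows "\<forall>\<^sub>F r in at_right 0. feasible D1 S E (\<lambda>i j. x i j + r * d i j)"
proof -
  have "\<forall>\<^sub>F r in at_right 0. \<forall>i\<in>D1. usage x i + r * usage d i \<le> 1"
    using feasibleD(1)[OF x] d finite_demand
    by (intro eventually_ball_finite ballI eventually_affine_le)
      (auto simp: feasible_direction_def)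
  moreover have "\<forall>\<^sub>F r in at_right 0. \<forall>j\<in>S. load x j + r * load d j \<le> 1"
    using feasibleD(2)[OF x] d finite_supply
    by (intro eventually_ball_finite ballI eventually_affine_le)
      (auto simp: feasible_direction_def)
  moreover have "finite {(i, j) \<in> E. i \<in> D1}"
    using finite_demand finite_supply edge_supply
    by (auto intro: finite_subset[of _ "D1 \<times> S"])
  then have "\<forall>\<^sub>F r in at_right 0. \<forall>e\<in>{(i, j) \<in> E. i \<in> D1}.
      - x (fst e) (snd e) + r * - d (fst e) (snd e) \<le> 0"
    using feasibleD(3)[OF x] d
    by (intro eventually_ball_finite ballI eventually_affine_le)
      (auto simp: feasible_direction_def)
  ultimately show ?thesis
    by eventually_elim (force simp: feasible_def sum.distrib simp flip: sum_distrib_left)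
qed

lemma objective_has_real_derivative_along_direction:
  assumes "\<And>a. (h has_real_derivative h' a) (at a)"
  shows "((\<lambda>r. objective D1 S E w h (\<lambda>i j. x i j + r * d i j)) has_real_derivative
      - (\<Sum>j\<in>S. h' (residual x j) * load d j)) (at 0)"
proof -
  have "((\<lambda>r. \<Sum>j\<in>S. 1 / w j * h (w j * (1 - (load x j + r * load d j)))) has_real_derivative
      (\<Sum>j\<in>S. 1 / w j * (h' (w j * (1 - (load x j + 0 * load d j))) * (w j * - load d j)))) (at 0)"
    by (intro DERIV_sum DERIV_cmult DERIV_chain2[OF assms]) (auto intro!: derivative_eq_intros)
  also have "(\<Sum>j\<in>S. 1 / w j * (h' (w j * (1 - (load x j + 0 * load d j))) * (w j * - load d j)))
      = (\<Sum>j\<in>S. - (h' (residual x j) * load d j))"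
    using weight_pos by (intro sum.cong) (force simp: residual_def)+
  also have "\<dots> = - (\<Sum>j\<in>S. h' (residual x j) * load d j)" by (rule sum_negf)
  finally show ?thesis by (simp add: objective_def sum.distrib sum_distrib_left)
qed

lemma optimal_solution_imp_no_descent_direction:
  assumes opt: "optimal_solution D1 S E w h x" and d: "feasible_direction x d"
    and deriv: "\<And>a. (h has_real_derivative h' a) (at a)"
  shows "(\<Sum>j\<in>S. h' (residual x j) * load d j) \<le> 0"
proof (rule ccontr)
  let ?F = "\<lambda>r. objective D1 S E w h (\<lambda>i j. x i j + r * d i j)"
  assume "\<not> ?thesis"
  then have "- (\<Sum>j\<in>S. h' (residual x j) * load d j) < 0" by simp
  from DERIV_neg_dec_right[OF objective_has_real_derivative_along_direction[OF deriv] this]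
  obtain e where e: "0 < e" "\<And>r. 0 < r \<Longrightarrow> r < e \<Longrightarrow> ?F r < ?F 0"
    by auto
  have "\<forall>\<^sub>F r in at_right 0. feasible D1 S E (\<lambda>i j. x i j + r * d i j)"
    using opt d
    by (intro eventually_feasible_along_direction) (auto simp: optimal_solution_def is_arg_min_def)
  moreover have "\<forall>\<^sub>F r in at_right 0. ?F r < ?F 0"
    using e by (auto simp: eventually_at_right)
  ultimately have "\<forall>\<^sub>F r::real in at_right 0. False"
    by eventually_elim (use opt in \<open>auto simp: optimal_solution_def is_arg_min_def\<close>)
  then show False by simp
qed

lemma optimal_solutionI_linearised:
  assumes "convex_on UNIV h" and "\<And>a. (h has_real_derivative h' a) (at a)"
    and "feasible D1 S E x"
    and linearised: "\<And>z. feasible D1 S E z \<Longrightarrow>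
      (\<Sum>j\<in>S. h' (residual x j) * load z j) \<le> (\<Sum>j\<in>S. h' (residual x j) * load x j)"
  shows "optimal_solution D1 S E w h x"
proof -
  have "objective D1 S E w h x \<le> objective D1 S E w h z" if z: "feasible D1 S E z" for z
  proof -
    have "h' (residual x j) * (load x j - load z j)
        \<le> 1 / w j * h (residual z j) - 1 / w j * h (residual x j)" if j: "j \<in> S" for j
    proof -
      have "h' (residual x j) * (load x j - load z j)
          = 1 / w j * (h' (residual x j) * (residual z j - residual x j))"
        using weight_pos[OF j] by (simp add: residual_def field_simps)
      also have "\<dots> \<le> 1 / w j * (h (residual z j) - h (residual x j))"
        using weight_pos[OF j] assms(2)
        by (intro mult_left_mono convex_on_imp_above_tangent[OF assms(1)]) auto
      finally show ?thesis by (simp add: right_diff_distrib)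
    qed
    then have "(\<Sum>j\<in>S. h' (residual x j) * (load x j - load z j))
        \<le> objective D1 S E w h z - objective D1 S E w h x"
      unfolding objective_def residual_def[symmetric] sum_subtractf[symmetric] by (rule sum_mono)
    then show ?thesis
      using linearised[OF z] by (simp add: right_diff_distrib sum_subtractf)
  qed
  then show ?thesis
    using assms(3) by (auto simp: optimal_solution_def is_arg_min_def not_less)
qed

section \<open>Alternating paths\<close>

text \<open>
  Load may be moved from \<open>q'\<close> to \<open>q\<close> through a common demand neighbour. An alternating path from
  \<open>p\<close> to \<open>q\<close> is a chain of such steps, along which load travels from \<open>q\<close> to \<open>p\<close>.
\<close>

definition reroutable :: "('d \<Rightarrow> 's \<Rightarrow> real) \<Rightarrow> 's \<Rightarrow> 's \<Rightarrow> bool" where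
  "reroutable x q q' \<longleftrightarrow> (\<exists>i\<in>D1. (i, q) \<in> E \<and> (i, q') \<in> E \<and> 0 < x i q')"

definition unimprovable :: "('d \<Rightarrow> 's \<Rightarrow> real) \<Rightarrow> bool" where
  "unimprovable x \<longleftrightarrow> feasible D1 S E x \<and>
     (\<forall>p\<in>S. \<forall>q\<in>S. load x p < 1 \<longrightarrow> (reroutable x)\<^sup>*\<^sup>* p q \<longrightarrow>
        residual x p \<le> residual x q \<and> (\<forall>i\<in>D1. (i, q) \<in> E \<longrightarrow> usage x i = 1))"

definition exchange :: "('d \<Rightarrow> 's \<Rightarrow> real) \<Rightarrow> 's \<Rightarrow> 's \<Rightarrow> ('d \<Rightarrow> 's \<Rightarrow> real) \<Rightarrow> bool" where
  "exchange x p q d \<longleftrightarrow>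
     (\<forall>i\<in>D1. usage d i = 0) \<and>
     (\<forall>k\<in>S. load d k = of_bool (k = p) - of_bool (k = q)) \<and>
     (\<forall>(i, j)\<in>E. i \<in> D1 \<longrightarrow> x i j = 0 \<longrightarrow> 0 \<le> d i j)"

definition unit_flow :: "'d \<Rightarrow> 's \<Rightarrow> 'd \<Rightarrow> 's \<Rightarrow> real" where
  "unit_flow a b i j = of_bool (i = a \<and> j = b)"

lemma usage_unit_flow:
  assumes "(a, b) \<in> E"
  shows "usage (unit_flow a b) i = of_bool (i = a)"
proof -
  have "usage (unit_flow a b) i = (\<Sum>j\<in>supply_nbrs S E i. if j = b then of_bool (i = a) else 0)"
    by (intro sum.cong) (auto simp: unit_flow_def)
  then show ?thesis
    using assms edge_supply finite_supply by (auto simp: supply_nbrs_def)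
qed

lemma load_unit_flow:
  assumes "(a, b) \<in> E" and "a \<in> D1"
  shows "load (unit_flow a b) j = of_bool (j = b)"
proof -
  have "load (unit_flow a b) j = (\<Sum>i\<in>demand_nbrs D1 E j. if i = a then of_bool (j = b) else 0)"
    by (intro sum.cong) (auto simp: unit_flow_def)
  then show ?thesis
    using assms finite_demand by (auto simp: demand_nbrs_def)
qed

lemma exchange_along_alternating_path:
  assumes "(reroutable x)\<^sup>*\<^sup>* p q"
  shows "\<exists>d. exchange x p q d"
  using assms
proof (induction rule: rtranclp_induct)
  case base
  have "exchange x p p (\<lambda>_ _. 0)" by (simp add: exchange_def)
  then show ?case by blast
next
  case (step q q')
  then obtain d i where d: "exchange x p q d"
    and i: "i \<in> D1" "(i, q) \<in> E" "(i, q') \<in> E" "0 < x i q'"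
    by (auto simp: reroutable_def)
  define d' where "d' a b = d a b + unit_flow i q a b - unit_flow i q' a b" for a b
  have "0 \<le> d' a b" if "(a, b) \<in> E" "a \<in> D1" "x a b = 0" for a b
  proof -
    have "0 \<le> d a b" using d that by (auto simp: exchange_def)
    then show ?thesis using that(3) i(4) by (auto simp: d'_def unit_flow_def)
  qed
  then have "exchange x p q' d'"
    using d i by (auto simp: exchange_def d'_def sum.distrib sum_subtractf
        usage_unit_flow load_unit_flow)
  then show ?case by blast
qed

lemma optimal_solution_imp_residual_deriv_le:
  assumes opt: "optimal_solution D1 S E w h x"
    and deriv: "\<And>a. (h has_real_derivative h' a) (at a)"
    and pq: "p \<in> S" "q \<in> S" "load x p < 1" "(reroutable x)\<^sup>*\<^sup>* p q"
  shows "h' (residual x p) \<le> h' (residual x q)"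
proof -
  obtain d where d: "exchange x p q d"
    using exchange_along_alternating_path[OF pq(4)] by blast
  have "feasible_direction x d"
    using d pq(3) by (auto simp: exchange_def feasible_direction_def)
  then have "(\<Sum>j\<in>S. h' (residual x j) * load d j) \<le> 0"
    by (rule optimal_solution_imp_no_descent_direction[OF opt _ deriv])
  also have "(\<Sum>j\<in>S. h' (residual x j) * load d j)
      = (\<Sum>j\<in>S. h' (residual x j) * (of_bool (j = p) - of_bool (j = q)))"
    using d by (intro sum.cong) (auto simp: exchange_def)
  also have "\<dots> = h' (residual x p) - h' (residual x q)"
    using pq(1,2) finite_supply
    by (simp add: right_diff_distrib sum_subtractf Int_def conj_commute cong: conj_cong)
  finally show ?thesis by simp
qed

lemma optimal_solution_imp_usage_eq_1:
  assumes opt: "optimal_solution D1 S E w h x"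
    and deriv: "\<And>a. (h has_real_derivative h' a) (at a)"
    and p: "p \<in> S" "load x p < 1" "0 < h' (residual x p)"
    and path: "(reroutable x)\<^sup>*\<^sup>* p q" and i: "i \<in> D1" "(i, q) \<in> E"
  shows "usage x i = 1"
proof (rule ccontr)
  assume slack: "usage x i \<noteq> 1"
  obtain d where d: "exchange x p q d"
    using exchange_along_alternating_path[OF path] by blast
  define d' where "d' a b = d a b + unit_flow i q a b" for a b
  have usage_d': "usage d' a = of_bool (a = i)" if "a \<in> D1" for a
    using d that i by (simp add: exchange_def d'_def sum.distrib usage_unit_flow)
  have load_d': "load d' k = of_bool (k = p)" if "k \<in> S" for k
    using d that i by (simp add: exchange_def d'_def sum.distrib load_unit_flow)
  have "0 \<le> d' a b" if "(a, b) \<in> E" "a \<in> D1" "x a b = 0" for a b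
    using d that by (auto simp: exchange_def d'_def unit_flow_def)
  then have "feasible_direction x d'"
    using p(2) slack by (auto simp: feasible_direction_def usage_d' load_d')
  then have "(\<Sum>j\<in>S. h' (residual x j) * load d' j) \<le> 0"
    by (rule optimal_solution_imp_no_descent_direction[OF opt _ deriv])
  also have "(\<Sum>j\<in>S. h' (residual x j) * load d' j)
      = (\<Sum>j\<in>S. h' (residual x j) * of_bool (j = p))"
    by (intro sum.cong) (auto simp: load_d')
  also have "\<dots> = h' (residual x p)"
    using p(1) finite_supply by (simp add: Int_def conj_commute cong: conj_cong)
  finally show False using p(3) by simp
qed

section \<open>Supporting prices\<close>

text \<open>
  The conditions say that \<open>c j - \<pi> j\<close> (\<open>j \<in> S\<close>) and the maximum of \<open>\<pi>\<close> over the neighbours of \<open>i\<close>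
  (\<open>i \<in> D1\<close>) are a dual solution, with complementary slackness, of maximising
  \<open>\<Sum>j\<in>S. c j * load x j\<close>.
\<close>

definition supporting_prices :: "('d \<Rightarrow> 's \<Rightarrow> real) \<Rightarrow> ('s \<Rightarrow> real) \<Rightarrow> ('s \<Rightarrow> real) \<Rightarrow> bool" where
  "supporting_prices x c \<pi> \<longleftrightarrow>
     (\<forall>j\<in>S. 0 \<le> \<pi> j \<and> \<pi> j \<le> c j) \<and>
     (\<forall>j\<in>S. load x j < 1 \<longrightarrow> \<pi> j = c j) \<and>
     (\<forall>q q'. reroutable x q q' \<longrightarrow> \<pi> q \<le> \<pi> q') \<and>
     (\<forall>(i, j)\<in>E. i \<in> D1 \<longrightarrow> usage x i < 1 \<longrightarrow> \<pi> j = 0)"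

lemma unimprovable_imp_supporting_prices:
  assumes x: "unimprovable x" and c_nonneg: "\<And>j. j \<in> S \<Longrightarrow> 0 \<le> c j"
    and c_mono: "\<And>p q. p \<in> S \<Longrightarrow> q \<in> S \<Longrightarrow> residual x p \<le> residual x q \<Longrightarrow> c p \<le> c q"
  shows "\<exists>\<pi>. supporting_prices x c \<pi>"
proof -
  define sources where "sources q = {p \<in> S. load x p < 1 \<and> (reroutable x)\<^sup>*\<^sup>* p q}" for q
  define \<pi> where "\<pi> q = Max (insert 0 (c ` sources q))" for q
  have finite_sources: "finite (sources q)" for q
    using finite_supply by (simp add: sources_def)
  have \<pi>_le: "\<pi> q \<le> c q" if "q \<in> S" for q
    using x that c_nonneg c_mono finite_sources
    by (auto simp: \<pi>_def sources_def unimprovable_def)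
  moreover have "0 \<le> \<pi> q" for q
    using finite_sources by (simp add: \<pi>_def)
  moreover have "\<pi> q = c q" if "q \<in> S" "load x q < 1" for q
  proof (rule antisym)
    have "q \<in> sources q" using that by (simp add: sources_def)
    then show "c q \<le> \<pi> q" using finite_sources by (simp add: \<pi>_def)
  qed (rule \<pi>_le[OF that(1)])
  moreover have "\<pi> q \<le> \<pi> q'" if "reroutable x q q'" for q q'
  proof -
    have "sources q \<subseteq> sources q'"
      using that by (auto simp: sources_def intro: rtranclp.rtrancl_into_rtrancl)
    then show ?thesis
      using finite_sources unfolding \<pi>_def by (intro Max_mono) auto
  qed
  moreover have "\<pi> j = 0" if "(i, j) \<in> E" "i \<in> D1" "usage x i < 1" for i j
  proof -
    have "sources j = {}"
      using x that edge_supply[OF that(1)] by (fastforce simp: sources_def unimprovable_def)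
    then show ?thesis by (simp add: \<pi>_def)
  qed
  ultimately show ?thesis unfolding supporting_prices_def by blast
qed

lemma sum_weighted_load:
  "(\<Sum>j\<in>S. \<pi> j * load y j) = (\<Sum>i\<in>D1. \<Sum>j\<in>supply_nbrs S E i. \<pi> j * y i j)"
  unfolding demand_nbrs_def supply_nbrs_def sum_distrib_left
  by (rule sum.swap_restrict[OF finite_supply finite_demand])

lemma supporting_prices_demand_value_le:
  assumes x: "feasible D1 S E x" and z: "feasible D1 S E z"
    and \<pi>: "supporting_prices x c \<pi>" and i: "i \<in> D1"
  shows "(\<Sum>j\<in>supply_nbrs S E i. \<pi> j * z i j) \<le> (\<Sum>j\<in>supply_nbrs S E i. \<pi> j * x i j)"
proof (cases "supply_nbrs S E i = {}")
  case False
  let ?N = "supply_nbrs S E i"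
  have finite_N: "finite ?N" using finite_supply by (simp add: supply_nbrs_def)
  obtain q where q: "q \<in> ?N" and q_max: "\<And>j. j \<in> ?N \<Longrightarrow> \<pi> j \<le> \<pi> q"
    using Max_in[of "\<pi> ` ?N"] Max_ge[of "\<pi> ` ?N"] finite_N False by fastforce
  have price_eq: "\<pi> j = \<pi> q" if "j \<in> ?N" "x i j \<noteq> 0" for j
  proof (rule antisym[OF q_max[OF that(1)]])
    have "reroutable x q j"
      using feasibleD(3)[OF x _ i, of j] i q that by (auto simp: reroutable_def supply_nbrs_def)
    then show "\<pi> q \<le> \<pi> j" using \<pi> by (simp add: supporting_prices_def)
  qed
  have "(\<Sum>j\<in>?N. \<pi> j * z i j) \<le> \<pi> q * usage z i"
    unfolding sum_distrib_left
    using q_max i feasibleD(3)[OF z]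
    by (intro sum_mono mult_right_mono) (auto simp: supply_nbrs_def)
  also have "\<dots> \<le> \<pi> q * usage x i"
  proof (cases "usage x i < 1")
    case True
    then show ?thesis using \<pi> q i by (auto simp: supporting_prices_def supply_nbrs_def)
  next
    case False
    then show ?thesis
      using feasibleD(1)[OF z i] \<pi> q
      by (intro mult_left_mono) (auto simp: supporting_prices_def supply_nbrs_def)
  qed
  also have "\<dots> = (\<Sum>j\<in>?N. \<pi> j * x i j)"
    unfolding sum_distrib_left using price_eq by (intro sum.cong) fastforce+
  finally show ?thesis .
qed simp

lemma supporting_prices_imp_weighted_load_le:
  assumes x: "feasible D1 S E x" and z: "feasible D1 S E z" and \<pi>: "supporting_prices x c \<pi>"
  shows "(\<Sum>j\<in>S. c j * load z j) \<le> (\<Sum>j\<in>S. c j * load x j)"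
proof -
  have "(\<Sum>j\<in>S. (c j - \<pi> j) * load z j) \<le> (\<Sum>j\<in>S. (c j - \<pi> j) * load x j)"
  proof (rule sum_mono)
    fix j assume j: "j \<in> S"
    show "(c j - \<pi> j) * load z j \<le> (c j - \<pi> j) * load x j"
    proof (cases "load x j < 1")
      case True
      then show ?thesis using \<pi> j by (simp add: supporting_prices_def)
    next
      case False
      then show ?thesis
        using \<pi> j feasibleD(2)[OF z j] by (intro mult_left_mono) (auto simp: supporting_prices_def)
    qed
  qed
  moreover have "(\<Sum>j\<in>S. \<pi> j * load z j) \<le> (\<Sum>j\<in>S. \<pi> j * load x j)"
    unfolding sum_weighted_load
    by (intro sum_mono supporting_prices_demand_value_le[OF x z \<pi>])
  ultimately show ?thesis by (simp add: left_diff_distrib sum_subtractf)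
qed

theorem optimal_solution_iff_unimprovable:
  assumes "h differentiable_on UNIV" and "mono h" and "strictly_convex_on UNIV h"
  shows "optimal_solution D1 S E w h x \<longleftrightarrow> unimprovable x"
proof -
  have deriv: "(h has_real_derivative deriv h a) (at a)" for a
    using assms(1) by (simp add: differentiable_on_def DERIV_deriv_iff_real_differentiable)
  have strict_mono: "strict_mono (deriv h)"
    using strictly_convex_on_imp_deriv_strict_mono_on[OF assms(3)] deriv by simp
  have pos: "0 < deriv h a" for a
    by (rule mono_strict_mono_deriv_pos[OF assms(2) deriv strict_mono])
  show ?thesis
  proof
    assume "optimal_solution D1 S E w h x"
    then show "unimprovable x"
      using optimal_solution_imp_residual_deriv_le[OF _ deriv]
        optimal_solution_imp_usage_eq_1[OF _ deriv _ _ pos] strict_mono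
      by (auto simp: unimprovable_def optimal_solution_def is_arg_min_def strict_mono_less_eq)
  next
    assume x: "unimprovable x"
    then have feasible: "feasible D1 S E x" by (simp add: unimprovable_def)
    obtain \<pi> where "supporting_prices x (\<lambda>j. deriv h (residual x j)) \<pi>"
      using unimprovable_imp_supporting_prices[OF x, of "\<lambda>j. deriv h (residual x j)"]
        pos strict_mono by (auto simp: strict_mono_less_eq less_imp_le)
    then show "optimal_solution D1 S E w h x"
      using supporting_prices_imp_weighted_load_le[OF feasible]
      by (intro optimal_solutionI_linearised[OF strictly_convex_on_imp_convex_on[OF assms(3)]
            deriv feasible])
  qed
qed

end

theorem mainTheorem9:
  fixes D D1 D2 :: "'d set" and S :: "'s set" and E :: "('d \<times> 's) set"
    and w :: "'s \<Rightarrow> real" and g_hat g :: "real \<Rightarrow> real" and x :: "'d \<Rightarrow> 's \<Rightarrow> real"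
  assumes "bipartite_graph D S E"
    and "D = D1 \<union> D2" and "D1 \<inter> D2 = {}"
    and "\<forall>j\<in>S. w j > 0"
    and "g_hat differentiable_on UNIV" and "mono g_hat" and "strictly_convex_on UNIV g_hat"
    and "g differentiable_on UNIV" and "mono g" and "strictly_convex_on UNIV g"
    and "optimal_solution D1 S E w g_hat x"
  shows "optimal_solution D1 S E w g x"
proof -
  interpret allocation_program D1 S E w
    using assms(1,2,4) by unfold_locales (auto simp: bipartite_graph_def)
  have "unimprovable x"
    using optimal_solution_iff_unimprovable[OF assms(5-7)] assms(11) by blast
  then show ?thesis
    using optimal_solution_iff_unimprovable[OF assms(8-10)] by blast
qed

end
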